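(* Let $G=(V,E)$ be a decomposable graph on $V=\{1,\dots,m\}$ with vertices ordered so that $V\in S_D$. Let $U$ be an $m\times m$ positive definite matrix and let $\alpha\in\mathbb{R}^m$ have nonnegative entries, with $z_G(U,\alpha)<\infty$. Let $Y_1,\dots,Y_n$ be an i.i.d. sample from $\mathcal{N}_m(0,LDL^T)$ where $(L,D)\in\Theta_G$, and let $S=\frac1n\sum_{i=1}^nY_iY_i^T$. If the prior distribution on $(L,D)$ is $\pi_{U,\alpha}$, then the posterior distribution of $(L,D)$ given $Y_1,\dots,Y_n$ is $\pi_{\widetilde U,\widetilde\alpha}$, where $\widetilde U=nS+U$ and $\widetilde\alpha=(n+\alpha_1,\dots,n+\alpha_m)$.
   Context: Edges are undirected, no loops. $G$ is decomposable if it has no induced cycle of length at least four. $P_G$ is the set of $m\times m$ symmetric positive definite matrices $\Sigma$ with $\Sigma_{ij}=0$ whenever $i\ne j$ and $(i,j)\notin E$. $\mathcal{L}_G$ is the set of $m\times m$ lower-triangular matrices $L$ with $L_{ii}=1$ for all $i$ and $L_{ij}=0$ for $i>j$, $(i,j)\notin E$. $\Theta_G=\{(L,D): L\in\mathcal{L}_G,\ D \text{ diagonal with } D_{ii}>0 \text{ for all } i\}$. Every positive definite $\Sigma$ has a unique modified Cholesky decomposition $\Sigma=LDL^T$ with $L$ lower-triangular with unit diagonal and $D$ diagonal with positive diagonal entries. $V\in S_D$ means: for every positive definite $\Sigma=LDL^T$ (modified Cholesky), $L\in\mathcal{L}_G\Leftrightarrow\Sigma\in P_G$. For $U$ positive definite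 and $\alpha\in\mathbb{R}^m$ with nonnegative entries, let $$\widetilde\pi_{U,\alpha}(L,D)=\exp\Big(-\tfrac12\Big\{\operatorname{tr}((LDL^T)^{-1}U)+\sum_{i=1}^m\alpha_i\log D_{ii}\Big\}\Big),\quad (L,D)\in\Theta_G,$$ a density with respect to $dL\,dD=\prod_{(i,j)\in E,\,i>j}dL_{ij}\prod_{i=1}^m dD_{ii}$, and $z_G(U,\alpha)=\int_{\Theta_G}\widetilde\pi_{U,\alpha}(L,D)\,dL\,dD$. When $z_G(U,\alpha)<\infty$, $\pi_{U,\alpha}$ denotes the probability distribution on $\Theta_G$ with density $\widetilde\pi_{U,\alpha}/z_G(U,\alpha)$. *)

theory Defs
  imports "HOL-Probability.Probability"
begin

text \<open>Used instead of \<open>real^'m\<close>, which would force the sort of \<open>'m\<close> to be exactly \<open>finite\<close>.\<close>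
type_synonym 'm real_vec = "(real, 'm) vec"
type_synonym 'm real_mat = "('m real_vec, 'm) vec"

text \<open>
  The vertex set \<open>{1,\<dots>,m}\<close> with its ordering is rendered as a finite linearly ordered type \<open>'m\<close>
  (so \<open>m = CARD('m)\<close>); a graph on it is given by its edge relation, which is assumed symmetric and
  irreflexive where it matters.
\<close>

definition simple_graph :: "'m rel \<Rightarrow> bool" where
  "simple_graph E \<longleftrightarrow> sym E \<and> irrefl E"

definition induced_cycle :: "'m rel \<Rightarrow> 'm list \<Rightarrow> bool" where
  "induced_cycle E vs \<longleftrightarrow>
     3 \<le> length vs \<and> distinct vs \<and>
     (\<forall>i < length vs. \<forall>j < length vs.
        (vs ! i, vs ! j) \<in> E \<longleftrightarrow> j = Suc i mod length vs \<or> i = Suc j mod length vs)"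

definition decomposable :: "'m rel \<Rightarrow> bool" where
  "decomposable E \<longleftrightarrow> \<not> (\<exists>vs. induced_cycle E vs \<and> 4 \<le> length vs)"

definition pos_def :: "('m::finite) real_mat \<Rightarrow> bool" where
  "pos_def A \<longleftrightarrow> transpose A = A \<and> (\<forall>x. x \<noteq> 0 \<longrightarrow> 0 < x \<bullet> (A *v x))"

definition P_graph :: "('m::finite) rel \<Rightarrow> 'm real_mat set" where
  "P_graph E = {\<Sigma>. pos_def \<Sigma> \<and> (\<forall>i j. i \<noteq> j \<and> (i, j) \<notin> E \<longrightarrow> \<Sigma> $ i $ j = 0)}"

definition unit_lower_triangular :: "('m::{finite,linorder}) real_mat \<Rightarrow> bool" where
  "unit_lower_triangular L \<longleftrightarrow> (\<forall>i. L $ i $ i = 1) \<and> (\<forall>i j. i < j \<longrightarrow> L $ i $ j = 0)"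

definition L_graph :: "('m::{finite,linorder}) rel \<Rightarrow> 'm real_mat set" where
  "L_graph E = {L. unit_lower_triangular L \<and> (\<forall>i j. j < i \<and> (i, j) \<notin> E \<longrightarrow> L $ i $ j = 0)}"

definition pos_diagonal :: "('m::finite) real_mat \<Rightarrow> bool" where
  "pos_diagonal D \<longleftrightarrow> (\<forall>i j. i \<noteq> j \<longrightarrow> D $ i $ j = 0) \<and> (\<forall>i. 0 < D $ i $ i)"

definition Theta :: "('m::{finite,linorder}) rel \<Rightarrow> ('m real_mat \<times> 'm real_mat) set" where
  "Theta E = {(L, D). L \<in> L_graph E \<and> pos_diagonal D}"

definition modified_Cholesky ::
    "('m::{finite,linorder}) real_mat \<Rightarrow> 'm real_mat \<Rightarrow> 'm real_mat \<Rightarrow> bool" where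
  "modified_Cholesky \<Sigma> L D \<longleftrightarrow>
     unit_lower_triangular L \<and> pos_diagonal D \<and> \<Sigma> = L ** D ** transpose L"

text \<open>The condition \<open>V \<in> S\<^sub>D\<close>; the ordering of \<open>V\<close> is the order of the type \<open>'m\<close>.\<close>
definition in_S_D :: "('m::{finite,linorder}) rel \<Rightarrow> bool" where
  "in_S_D E \<longleftrightarrow>
     (\<forall>\<Sigma> L D. pos_def \<Sigma> \<and> modified_Cholesky \<Sigma> L D \<longrightarrow> (L \<in> L_graph E \<longleftrightarrow> \<Sigma> \<in> P_graph E))"

text \<open>
  The reference measure \<open>dL dD\<close> on \<open>\<Theta>\<^sub>G\<close>: product Lebesgue measure in the free coordinates
  \<open>L\<^sub>i\<^sub>j\<close> (\<open>(i,j) \<in> E\<close>, \<open>i > j\<close>) and \<open>D\<^sub>i\<^sub>i\<close>, transported to pairs of matrices by filling in the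
  remaining entries.
\<close>
definition lower_edges :: "('m::linorder) rel \<Rightarrow> ('m \<times> 'm) set" where
  "lower_edges E = {(i, j). (i, j) \<in> E \<and> j < i}"

definition matrices_of_coords ::
    "('m::{finite,linorder}) rel \<Rightarrow> ('m \<times> 'm \<Rightarrow> real) \<times> ('m \<Rightarrow> real) \<Rightarrow> 'm real_mat \<times> 'm real_mat" where
  "matrices_of_coords E = (\<lambda>(l, d).
     (\<chi> i j. if i = j then 1 else if (i, j) \<in> lower_edges E then l (i, j) else 0,
      \<chi> i j. if i = j then d i else 0))"

definition dL_dD :: "('m::{finite,linorder}) rel \<Rightarrow> ('m real_mat \<times> 'm real_mat) measure" where
  "dL_dD E = restrict_space
     (distr (PiM (lower_edges E) (\<lambda>_. lborel) \<Otimes>\<^sub>M PiM UNIV (\<lambda>_. lborel)) borel (matrices_of_coords E))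
     (Theta E)"

definition pi_unnorm :: "('m::finite) real_mat \<Rightarrow> 'm real_vec \<Rightarrow> 'm real_mat \<times> 'm real_mat \<Rightarrow> real" where
  "pi_unnorm U \<alpha> = (\<lambda>(L, D).
     exp (- (1/2) * (trace (matrix_inv (L ** D ** transpose L) ** U)
                     + (\<Sum>i\<in>UNIV. \<alpha> $ i * ln (D $ i $ i)))))"

definition z_graph :: "('m::{finite,linorder}) rel \<Rightarrow> 'm real_mat \<Rightarrow> 'm real_vec \<Rightarrow> ennreal" where
  "z_graph E U \<alpha> = (\<integral>\<^sup>+ \<theta>. ennreal (pi_unnorm U \<alpha> \<theta>) \<partial>dL_dD E)"

text \<open>If \<open>z_graph E U \<alpha> = \<infinity>\<close> this is the null measure, in particular not a probability measure.\<close>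
definition pi_dist ::
    "('m::{finite,linorder}) rel \<Rightarrow> 'm real_mat \<Rightarrow> 'm real_vec \<Rightarrow> ('m real_mat \<times> 'm real_mat) measure" where
  "pi_dist E U \<alpha> = density (dL_dD E) (\<lambda>\<theta>. ennreal (pi_unnorm U \<alpha> \<theta>) / z_graph E U \<alpha>)"

definition multivariate_normal :: "('m::finite) real_vec \<Rightarrow> 'm real_mat \<Rightarrow> 'm real_vec measure" where
  "multivariate_normal \<mu> \<Sigma> = density lborel (\<lambda>x. ennreal
     (exp (- (1/2) * ((x - \<mu>) \<bullet> (matrix_inv \<Sigma> *v (x - \<mu>))))
      / sqrt ((2 * pi) ^ CARD('m) * det \<Sigma>)))"

text \<open>
  \<open>K\<close> is a regular conditional distribution of \<open>X\<close> (with values in \<open>MX\<close>) given \<open>Y\<close> (with values in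
  \<open>MY\<close>) on the probability space \<open>M\<close>: a probability kernel with
  \<open>P(X \<in> A | Y) = K(Y)(A)\<close> almost surely, for each measurable \<open>A\<close>.
\<close>
definition cond_distribution ::
    "'w measure \<Rightarrow> 'x measure \<Rightarrow> ('w \<Rightarrow> 'x) \<Rightarrow> 'y measure \<Rightarrow> ('w \<Rightarrow> 'y) \<Rightarrow> ('y \<Rightarrow> 'x measure) \<Rightarrow> bool" where
  "cond_distribution M MX X MY Y K \<longleftrightarrow>
     X \<in> M \<rightarrow>\<^sub>M MX \<and> Y \<in> M \<rightarrow>\<^sub>M MY \<and> K \<in> MY \<rightarrow>\<^sub>M prob_algebra MX \<and>
     (\<forall>A \<in> sets MX. AE \<omega> in M.
        real_cond_exp M (vimage_algebra (space M) Y MY) (\<lambda>\<omega>'. indicator A (X \<omega>')) \<omega>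
          = measure (K (Y \<omega>)) A)"

definition outer_product :: "('m::finite) real_vec \<Rightarrow> 'm real_vec \<Rightarrow> 'm real_mat" where
  "outer_product x y = (\<chi> i j. x $ i * y $ j)"

definition sample_cov :: "nat \<Rightarrow> (nat \<Rightarrow> ('m::finite) real_vec) \<Rightarrow> 'm real_mat" where
  "sample_cov n y = (1 / real n) *\<^sub>R (\<Sum>k = 1..n. outer_product (y k) (y k))"

end

theory Submission
  imports Defs
begin

text \<open>
  The likelihood of \<open>Y\<^sub>1, \<dots>, Y\<^sub>n\<close> is a constant times \<open>pi_unnorm (n S) (n, \<dots>, n)\<close>, and these unnormalized
  densities multiply by adding their parameters, so Bayes' theorem gives the posterior. For it to be a
  probability kernel at every sample, \<open>z_graph E (n S + U) (n + \<alpha>)\<close> must be finite and positive.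
  In \<open>tr ((L D L\<^sup>T)\<^sup>-\<^sup>1 U) = \<Sum>\<^sub>i q\<^sub>i / D\<^sub>i\<^sub>i\<close> the \<open>q\<^sub>i\<close> are the values of the quadratic form of \<open>U\<close> at
  the rows of \<open>L\<^sup>-\<^sup>1\<close>; these rows have an entry 1, so \<open>q\<^sub>i\<close> is bounded away from 0. Hence the posterior
  density is at most a constant times \<open>pi_unnorm (U/2) \<alpha>\<close>, whose integral is a multiple of
  \<open>z_graph E U \<alpha>\<close> by the substitution \<open>D \<mapsto> D/2\<close>.
\<close>

section \<open>Bayes' theorem for regular conditional distributions\<close>

lemma sigma_finite_subalgebra_vimage_algebra:
  assumes "prob_space M" and Y: "Y \<in> M \<rightarrow>\<^sub>M MY"
  shows "sigma_finite_subalgebra M (vimage_algebra (space M) Y MY)"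
proof -
  interpret prob_space M by fact
  have "subalgebra M (vimage_algebra (space M) Y MY)"
    using Y by (auto simp: subalgebra_def sets_vimage_algebra2 measurable_space measurable_sets)
  then have "finite_measure_subalgebra M (vimage_algebra (space M) Y MY)"
    by (simp add: finite_measure_axioms finite_measure_subalgebra_def finite_measure_subalgebra_axioms_def)
  then interpret finite_measure_subalgebra M "vimage_algebra (space M) Y MY" .
  show ?thesis ..
qed

lemma cond_distributionI:
  assumes M: "prob_space M"
    and X[measurable]: "X \<in> M \<rightarrow>\<^sub>M MX" and Y[measurable]: "Y \<in> M \<rightarrow>\<^sub>M MY"
    and K[measurable]: "K \<in> MY \<rightarrow>\<^sub>M prob_algebra MX"
    and joint: "\<And>A B. A \<in> sets MX \<Longrightarrow> B \<in> sets MY \<Longrightarrow>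
      emeasure M {\<omega> \<in> space M. X \<omega> \<in> A \<and> Y \<omega> \<in> B}
        = (\<integral>\<^sup>+y. emeasure (K y) A * indicator B y \<partial>distr M MY Y)"
  shows "cond_distribution M MX X MY Y K"
  unfolding cond_distribution_def
proof (intro conjI ballI X Y K)
  interpret prob_space M by fact
  let ?F = "vimage_algebra (space M) Y MY"
  interpret sigma_finite_subalgebra M ?F
    using M Y by (rule sigma_finite_subalgebra_vimage_algebra)
  fix A assume A[measurable]: "A \<in> sets MX"
  have prob_K: "prob_space (K y)" if "y \<in> space MY" for y
    using measurable_space[OF K that] by (simp add: space_prob_algebra)
  have mK[measurable]: "(\<lambda>y. measure (K y) A) \<in> borel_measurable MY"
    using A measurable_prob_algebraD[OF K] by measurable
  have YF: "Y \<in> ?F \<rightarrow>\<^sub>M MY"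
    by (rule measurable_vimage_algebra1) (auto simp: measurable_space[OF Y])
  have bd: "norm (measure (K (Y \<omega>)) A) \<le> 1" if "\<omega> \<in> space M" for \<omega>
    using prob_space.prob_le_1[OF prob_K] measurable_space[OF Y that] by simp
  have int2: "integrable M (\<lambda>\<omega>. measure (K (Y \<omega>)) A)"
    by (intro integrable_const_bound[where B=1] AE_I2 bd) measurable
  have int1: "integrable M (\<lambda>\<omega>. indicator A (X \<omega>) :: real)"
    by (rule integrable_const_bound[where B=1]) (auto intro!: AE_I2)
  show "AE \<omega> in M. real_cond_exp M ?F (\<lambda>\<omega>'. indicator A (X \<omega>')) \<omega> = measure (K (Y \<omega>)) A"
  proof (rule real_cond_exp_charact)
    fix C assume "C \<in> sets ?F"
    then obtain B where B[measurable]: "B \<in> sets MY" and C: "C = Y -` B \<inter> space M"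
      using measurable_space[OF Y] by (auto simp: sets_vimage_algebra2)
    have "ennreal (\<integral>\<omega>\<in>C. indicator A (X \<omega>) \<partial>M)
        = (\<integral>\<^sup>+\<omega>. ennreal (indicator B (Y \<omega>) * indicator A (X \<omega>)) \<partial>M)"
      unfolding set_lebesgue_integral_def
      by (subst nn_integral_eq_integral[symmetric])
        (auto simp: C indicator_def intro!: integrable_const_bound[where B=1] nn_integral_cong)
    also have "\<dots> = (\<integral>\<^sup>+\<omega>. indicator {\<omega> \<in> space M. X \<omega> \<in> A \<and> Y \<omega> \<in> B} \<omega> \<partial>M)"
      by (intro nn_integral_cong) (auto simp: indicator_def)
    also have "\<dots> = emeasure M {\<omega> \<in> space M. X \<omega> \<in> A \<and> Y \<omega> \<in> B}"
      by (rule nn_integral_indicator) measurable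
    also have "\<dots> = (\<integral>\<^sup>+\<omega>. emeasure (K (Y \<omega>)) A * indicator B (Y \<omega>) \<partial>M)"
      using A measurable_prob_algebraD[OF K]
      by (subst joint) (auto simp: nn_integral_distr)
    also have "\<dots> = (\<integral>\<^sup>+\<omega>. ennreal (indicator C \<omega> * measure (K (Y \<omega>)) A) \<partial>M)"
      using prob_K measurable_space[OF Y]
      by (intro nn_integral_cong)
        (auto simp: C indicator_def finite_measure.emeasure_eq_measure prob_space.finite_measure)
    also have "\<dots> = ennreal (\<integral>\<omega>\<in>C. measure (K (Y \<omega>)) A \<partial>M)"
      unfolding set_lebesgue_integral_def
      by (subst nn_integral_eq_integral)
        (auto simp: C indicator_def measurable_If intro!: integrable_const_bound[where B=1] AE_I2 bd[simplified])
    finally show "(\<integral>\<omega>\<in>C. indicator A (X \<omega>) \<partial>M) = (\<integral>\<omega>\<in>C. measure (K (Y \<omega>)) A \<partial>M)"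
      by (subst (asm) ennreal_inj)
        (auto simp: set_lebesgue_integral_def intro!: Bochner_Integration.integral_nonneg)
  qed (use int1 int2 YF in auto)
qed

lemma emeasure_joint_cond_distribution:
  assumes M: "prob_space M" and cond: "cond_distribution M MX X MY Y K"
    and A[measurable]: "A \<in> sets MX" and B[measurable]: "B \<in> sets MY"
  shows "emeasure M {\<omega> \<in> space M. X \<omega> \<in> A \<and> Y \<omega> \<in> B}
    = (\<integral>\<^sup>+y. emeasure (K y) A * indicator B y \<partial>distr M MY Y)"
proof -
  interpret prob_space M by fact
  have X[measurable]: "X \<in> M \<rightarrow>\<^sub>M MX" and Y[measurable]: "Y \<in> M \<rightarrow>\<^sub>M MY"
    and K[measurable]: "K \<in> MY \<rightarrow>\<^sub>M prob_algebra MX"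
    using cond by (auto simp: cond_distribution_def)
  let ?F = "vimage_algebra (space M) Y MY"
  interpret sigma_finite_subalgebra M ?F
    using M Y by (rule sigma_finite_subalgebra_vimage_algebra)
  have ae: "AE \<omega> in M. real_cond_exp M ?F (\<lambda>\<omega>'. indicator A (X \<omega>')) \<omega> = measure (K (Y \<omega>)) A"
    using cond A by (auto simp: cond_distribution_def)
  have prob_K: "prob_space (K y)" if "y \<in> space MY" for y
    using measurable_space[OF K that] by (simp add: space_prob_algebra)
  have mK[measurable]: "(\<lambda>y. measure (K y) A) \<in> borel_measurable MY"
    using A measurable_prob_algebraD[OF K] by measurable
  have bd: "norm (measure (K (Y \<omega>)) A) \<le> 1" if "\<omega> \<in> space M" for \<omega>
    using prob_space.prob_le_1[OF prob_K] measurable_space[OF Y that] by simp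
  have int1: "integrable M (\<lambda>\<omega>. indicator A (X \<omega>) :: real)"
    by (rule integrable_const_bound[where B=1]) (auto intro!: AE_I2)
  define C where "C = Y -` B \<inter> space M"
  have C: "C \<in> sets ?F"
    using measurable_space[OF Y] by (auto simp: sets_vimage_algebra2 C_def)
  have [measurable]: "C \<in> sets M"
    unfolding C_def by measurable
  have "emeasure M {\<omega> \<in> space M. X \<omega> \<in> A \<and> Y \<omega> \<in> B}
      = (\<integral>\<^sup>+\<omega>. indicator {\<omega> \<in> space M. X \<omega> \<in> A \<and> Y \<omega> \<in> B} \<omega> \<partial>M)"
    by (rule nn_integral_indicator[symmetric]) measurable
  also have "\<dots> = (\<integral>\<^sup>+\<omega>. ennreal (indicator B (Y \<omega>) * indicator A (X \<omega>)) \<partial>M)"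
    by (intro nn_integral_cong) (auto simp: indicator_def)
  also have "\<dots> = ennreal (\<integral>\<omega>\<in>C. indicator A (X \<omega>) \<partial>M)"
    unfolding set_lebesgue_integral_def
    by (subst nn_integral_eq_integral[symmetric])
      (auto simp: C_def indicator_def intro!: integrable_const_bound[where B=1] nn_integral_cong)
  also have "(\<integral>\<omega>\<in>C. indicator A (X \<omega>) \<partial>M)
      = (\<integral>\<omega>\<in>C. real_cond_exp M ?F (\<lambda>\<omega>'. indicator A (X \<omega>')) \<omega> \<partial>M)"
    using int1 C by (rule real_cond_exp_intA)
  also have "\<dots> = (\<integral>\<omega>\<in>C. measure (K (Y \<omega>)) A \<partial>M)"
    unfolding set_lebesgue_integral_def using ae
    by (intro Bochner_Integration.integral_cong_AE) auto
  also have "ennreal \<dots> = (\<integral>\<^sup>+\<omega>. ennreal (indicator C \<omega> * measure (K (Y \<omega>)) A) \<partial>M)"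
    unfolding set_lebesgue_integral_def
    by (subst nn_integral_eq_integral)
      (auto simp: C_def indicator_def measurable_If intro!: integrable_const_bound[where B=1] AE_I2 bd[simplified])
  also have "\<dots> = (\<integral>\<^sup>+\<omega>. emeasure (K (Y \<omega>)) A * indicator B (Y \<omega>) \<partial>M)"
    using prob_K measurable_space[OF Y]
    by (intro nn_integral_cong)
      (auto simp: C_def indicator_def finite_measure.emeasure_eq_measure prob_space.finite_measure)
  also have "\<dots> = (\<integral>\<^sup>+y. emeasure (K y) A * indicator B y \<partial>distr M MY Y)"
    using A measurable_prob_algebraD[OF K] by (subst nn_integral_distr) auto
  finally show ?thesis .
qed

lemma prob_kernel_density:
  assumes "prob_space P" and sets_P: "sets P = sets MX"
    and f[measurable]: "(\<lambda>(x, y). f x y) \<in> borel_measurable (MX \<Otimes>\<^sub>M MY)"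
    and int: "\<And>y. y \<in> space MY \<Longrightarrow> (\<integral>\<^sup>+x. f x y \<partial>P) = 1"
  shows "(\<lambda>y. density P (\<lambda>x. f x y)) \<in> MY \<rightarrow>\<^sub>M prob_algebra MX"
proof -
  interpret prob_space P by fact
  have [measurable_cong]: "sets P = sets MX" by fact
  have [measurable]: "(\<lambda>x. f x y) \<in> borel_measurable MX" if "y \<in> space MY" for y
    using that by measurable
  have prob: "prob_space (density P (\<lambda>x. f x y))" if "y \<in> space MY" for y
    using int[OF that] that by (intro prob_spaceI) (simp add: emeasure_density cong: nn_integral_cong)
  show ?thesis
  proof (intro measurable_prob_algebraI measurable_subprob_algebra)
    fix A assume [measurable]: "A \<in> sets MX"
    have "(\<lambda>y. \<integral>\<^sup>+x. f x y * indicator A x \<partial>P) \<in> borel_measurable MY"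
      by measurable
    then show "(\<lambda>y. emeasure (density P (\<lambda>x. f x y)) A) \<in> borel_measurable MY"
      by (rule measurable_cong[THEN iffD1, rotated]) (simp add: emeasure_density)
  qed (use prob sets_P in \<open>auto intro: prob_space_imp_subprob_space\<close>)
qed

proposition bayes_cond_distribution:
  assumes M: "prob_space M" and cond: "cond_distribution M MY Y MX X K"
    and Q: "sigma_finite_measure Q" "sets Q = sets MY"
    and f[measurable]: "(\<lambda>(x, y). f x y) \<in> borel_measurable (MX \<Otimes>\<^sub>M MY)"
    and K: "\<And>x. x \<in> space MX \<Longrightarrow> K x = density Q (f x)"
    and P: "P = distr M MX X"
    and g: "\<And>y. y \<in> space MY \<Longrightarrow> g y = (\<integral>\<^sup>+x. f x y \<partial>P)"
    and g_pos: "\<And>y. y \<in> space MY \<Longrightarrow> 0 < g y" and g_fin: "\<And>y. y \<in> space MY \<Longrightarrow> g y < \<infinity>"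
    and K': "\<And>y. y \<in> space MY \<Longrightarrow> K' y = density P (\<lambda>x. f x y / g y)"
  shows "cond_distribution M MX X MY Y K'"
proof -
  interpret prob_space M by fact
  interpret Q: sigma_finite_measure Q by fact
  have Y[measurable]: "Y \<in> M \<rightarrow>\<^sub>M MY" and X[measurable]: "X \<in> M \<rightarrow>\<^sub>M MX"
    using cond by (auto simp: cond_distribution_def)
  interpret P: prob_space P unfolding P by (rule prob_space_distr) measurable
  have [measurable_cong]: "sets Q = sets MY" "sets P = sets MX"
    using Q by (auto simp: P)
  interpret PQ: pair_sigma_finite P Q ..
  have fx[measurable]: "f x \<in> borel_measurable MY" if "x \<in> space MX" for x
    using measurable_compose[OF measurable_Pair1'[OF that] f] by simp
  have fy[measurable]: "(\<lambda>x. f x y) \<in> borel_measurable MX" if "y \<in> space MY" for y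
    using measurable_compose[OF measurable_Pair2'[OF that] f] by simp
  have "(\<lambda>y. \<integral>\<^sup>+x. f x y \<partial>P) \<in> borel_measurable MY"
    by measurable
  then have [measurable]: "g \<in> borel_measurable MY"
    by (rule measurable_cong[THEN iffD1, rotated]) (simp add: g)
  have space: "space P = space MX" "space Q = space MY"
    using Q by (auto simp: P dest: sets_eq_imp_space_eq)
  have joint: "emeasure M {\<omega> \<in> space M. X \<omega> \<in> A \<and> Y \<omega> \<in> B}
      = (\<integral>\<^sup>+y. (\<integral>\<^sup>+x. f x y * indicator A x \<partial>P) * indicator B y \<partial>Q)"
    if [measurable]: "A \<in> sets MX" "B \<in> sets MY" for A B
  proof -
    have "emeasure M {\<omega> \<in> space M. X \<omega> \<in> A \<and> Y \<omega> \<in> B}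
        = (\<integral>\<^sup>+x. emeasure (K x) B * indicator A x \<partial>P)"
      using emeasure_joint_cond_distribution[OF M cond \<open>B \<in> _\<close> \<open>A \<in> _\<close>] by (simp add: P conj_commute)
    also have "\<dots> = (\<integral>\<^sup>+x. \<integral>\<^sup>+y. f x y * indicator A x * indicator B y \<partial>Q \<partial>P)"
    proof (intro nn_integral_cong)
      fix x assume "x \<in> space P"
      then have x: "x \<in> space MX" by (simp add: space)
      show "emeasure (K x) B * indicator A x = (\<integral>\<^sup>+y. f x y * indicator A x * indicator B y \<partial>Q)"
        using x by (cases "x \<in> A") (simp_all add: K emeasure_density)
    qed
    also have "\<dots> = (\<integral>\<^sup>+y. \<integral>\<^sup>+x. f x y * indicator A x * indicator B y \<partial>P \<partial>Q)"
      by (rule PQ.Fubini'[symmetric]) measurable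
    also have "\<dots> = (\<integral>\<^sup>+y. (\<integral>\<^sup>+x. f x y * indicator A x \<partial>P) * indicator B y \<partial>Q)"
      by (intro nn_integral_cong nn_integral_multc) (simp add: space)
    finally show ?thesis .
  qed
  have law: "distr M MY Y = density Q g"
  proof (rule measure_eqI)
    fix B assume "B \<in> sets (distr M MY Y)"
    then have B[measurable]: "B \<in> sets MY" by simp
    have "emeasure (distr M MY Y) B = emeasure M {\<omega> \<in> space M. X \<omega> \<in> space MX \<and> Y \<omega> \<in> B}"
      using measurable_space[OF X] by (auto simp: emeasure_distr intro!: arg_cong[where f="emeasure M"])
    also have "\<dots> = (\<integral>\<^sup>+y. g y * indicator B y \<partial>Q)"
      by (subst joint) (auto simp: space g intro!: nn_integral_cong arg_cong2[where f="(*)"])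
    finally show "emeasure (distr M MY Y) B = emeasure (density Q g) B"
      by (simp add: emeasure_density)
  qed (simp add: Q)
  have K'_meas: "K' \<in> MY \<rightarrow>\<^sub>M prob_algebra MX"
  proof -
    have "(\<lambda>y. density P (\<lambda>x. f x y / g y)) \<in> MY \<rightarrow>\<^sub>M prob_algebra MX"
    proof (rule prob_kernel_density)
      fix y assume y: "y \<in> space MY"
      then show "(\<integral>\<^sup>+x. f x y / g y \<partial>P) = 1"
        using g_pos[OF y] g_fin[OF y] by (simp add: nn_integral_divide g[symmetric])
    qed (use P.prob_space_axioms in \<open>auto simp: P\<close>)
    then show ?thesis
      by (rule measurable_cong[THEN iffD1, rotated]) (simp add: K')
  qed
  show ?thesis
  proof (rule cond_distributionI[OF M X Y K'_meas])
    fix A B assume [measurable]: "A \<in> sets MX" "B \<in> sets MY"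
    have "(\<integral>\<^sup>+y. emeasure (K' y) A * indicator B y \<partial>distr M MY Y)
        = (\<integral>\<^sup>+y. g y * (emeasure (K' y) A * indicator B y) \<partial>Q)"
      unfolding law using measurable_prob_algebraD[OF K'_meas]
      by (subst nn_integral_density) auto
    also have "\<dots> = (\<integral>\<^sup>+y. (\<integral>\<^sup>+x. f x y * indicator A x \<partial>P) * indicator B y \<partial>Q)"
    proof (intro nn_integral_cong)
      fix y assume "y \<in> space Q"
      then have y: "y \<in> space MY" by (simp add: space)
      have "emeasure (K' y) A = (\<integral>\<^sup>+x. f x y * indicator A x / g y \<partial>P)"
        using y by (simp add: K' emeasure_density divide_ennreal_def ac_simps)
      also have "\<dots> = (\<integral>\<^sup>+x. f x y * indicator A x \<partial>P) / g y"
        using y by (intro nn_integral_divide) simp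
      finally show "g y * (emeasure (K' y) A * indicator B y)
          = (\<integral>\<^sup>+x. f x y * indicator A x \<partial>P) * indicator B y"
        using g_pos[OF y] g_fin[OF y]
        by (simp add: ennreal_times_divide mult.assoc[symmetric] ennreal_mult_divide_eq mult.commute[of "g y"])
    qed
    finally show "emeasure M {\<omega> \<in> space M. X \<omega> \<in> A \<and> Y \<omega> \<in> B}
        = (\<integral>\<^sup>+y. emeasure (K' y) A * indicator B y \<partial>distr M MY Y)"
      by (simp add: joint)
  qed
qed

section \<open>The modified Cholesky decomposition\<close>

lemma matrix_inv_eqI:
  fixes A B :: "'n::finite real_mat"
  assumes "A ** B = mat 1"
  shows "matrix_inv A = B"
proof -
  have BA: "B ** A = mat 1"
    using assms matrix_left_right_inverse by blast
  then have "\<exists>A'. A ** A' = mat 1 \<and> A' ** A = mat 1"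
    using assms by blast
  then have "matrix_inv A ** A = mat 1"
    unfolding matrix_inv_def by (rule someI2_ex) blast
  then have "matrix_inv A = matrix_inv A ** A ** B"
    by (metis assms matrix_mul_assoc matrix_mul_rid)
  then show ?thesis
    using \<open>matrix_inv A ** A = mat 1\<close> by simp
qed

lemma matrix_inv_right:
  fixes A :: "'n::finite real_mat"
  assumes "det A \<noteq> 0"
  shows "A ** matrix_inv A = mat 1"
  using assms matrix_inv_eqI unfolding invertible_det_nz[symmetric] invertible_def by blast

lemma matrix_inv_entry:
  fixes A :: "'n::finite real_mat"
  assumes "det A \<noteq> 0"
  shows "matrix_inv A $ k $ l
    = det (\<chi> i j. if j = k then (if i = l then 1 else 0) else A $ i $ j) / det A"
proof -
  have "A *v (matrix_inv A *v axis l 1) = axis l 1"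
    using matrix_inv_right[OF assms] by (simp add: matrix_vector_mul_assoc)
  then have "matrix_inv A *v axis l 1
      = (\<chi> k. det (\<chi> i j. if j = k then axis l 1 $ i else A $ i $ j) / det A)"
    by (simp add: cramer[OF assms])
  then have "column l (matrix_inv A) $ k
      = det (\<chi> i j. if j = k then axis l 1 $ i else A $ i $ j) / det A"
    by (simp add: matrix_vector_mult_basis)
  then show ?thesis
    by (simp add: column_def axis_def cong: if_cong)
qed

text \<open>The library's \<open>det_lowerdiagonal\<close> needs the class \<open>wellorder\<close>, which is not available here.\<close>
lemma permutes_le_imp_id:
  fixes p :: "'a::{finite,linorder} \<Rightarrow> 'a"
  assumes "inj p" "\<And>i. p i \<le> i"
  shows "p = id"
proof (rule ccontr)
  assume "p \<noteq> id"
  then have ne: "{i. p i \<noteq> i} \<noteq> {}" by (auto simp: fun_eq_iff)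
  define i where "i = Min {i. p i \<noteq> i}"
  have i: "p i \<noteq> i" using Min_in[OF _ ne] by (simp add: i_def)
  then have "p i < i" using assms(2)[of i] by simp
  moreover have "p (p i) = p i"
  proof (rule ccontr)
    assume "p (p i) \<noteq> p i"
    then have "i \<le> p i" unfolding i_def by (intro Min_le) auto
    with \<open>p i < i\<close> show False by simp
  qed
  ultimately show False
    using i assms(1) by (auto dest: injD)
qed

lemma det_unit_lower_triangular:
  fixes L :: "'m::{finite,linorder} real_mat"
  assumes "unit_lower_triangular L"
  shows "det L = 1"
proof -
  let ?t = "\<lambda>p. of_int (sign p) * (\<Prod>i\<in>UNIV. L $ i $ p i) :: real"
  have "?t p = 0" if p: "p permutes UNIV" "p \<noteq> id" for p
  proof -
    obtain i where "i < p i"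
      using permutes_le_imp_id[OF permutes_inj[OF p(1)]] p(2) by (meson not_le)
    then have "L $ i $ p i = 0"
      using assms by (simp add: unit_lower_triangular_def)
    then have "(\<Prod>i\<in>UNIV. L $ i $ p i) = 0"
      by (intro prod_zero) auto
    then show ?thesis by simp
  qed
  then have "det L = sum ?t {id}"
    unfolding det_def by (intro sum.mono_neutral_right) (auto simp: permutes_id)
  also have "\<dots> = 1"
    using assms by (simp add: unit_lower_triangular_def sign_id)
  finally show ?thesis .
qed

lemma det_modified_Cholesky:
  fixes L D :: "'m::{finite,linorder} real_mat"
  assumes "unit_lower_triangular L" "pos_diagonal D"
  shows "det (L ** D ** transpose L) = (\<Prod>i\<in>UNIV. D $ i $ i)"
  using assms by (simp add: det_mul det_unit_lower_triangular det_diagonal pos_diagonal_def)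

lemma matrix_inv_unit_lower_triangular_diag:
  fixes L :: "'m::{finite,linorder} real_mat"
  assumes L: "unit_lower_triangular L"
  shows "matrix_inv L $ i $ i = 1"
proof -
  let ?R = "matrix_inv L"
  have "L ** ?R = mat 1"
    using det_unit_lower_triangular[OF L] by (intro matrix_inv_right) simp
  then have RL: "?R ** L = mat 1"
    using matrix_left_right_inverse by blast
  have entry: "(\<Sum>k\<in>UNIV. ?R $ i $ k * L $ k $ j) = (if i = j then 1 else 0)" for j
    using arg_cong[OF RL, of "\<lambda>A. A $ i $ j"] by (simp add: matrix_matrix_mult_def mat_def)
  have single: "(\<Sum>k\<in>UNIV. ?R $ i $ k * L $ k $ j) = ?R $ i $ j"
    if "\<And>k. j < k \<Longrightarrow> ?R $ i $ k = 0" for j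
  proof -
    have "(\<Sum>k\<in>UNIV. ?R $ i $ k * L $ k $ j) = (\<Sum>k\<in>{j}. ?R $ i $ k * L $ k $ j)"
      using that L by (intro sum.mono_neutral_right) (auto simp: unit_lower_triangular_def neq_iff)
    then show ?thesis using L by (simp add: unit_lower_triangular_def)
  qed
  have zero: "?R $ i $ j = 0" if "i < j" for j
    using that
  proof (induction "card {k. j < k}" arbitrary: j rule: less_induct)
    case less
    have "?R $ i $ k = 0" if "j < k" for k
      using that less.prems by (intro less.hyps psubset_card_mono) auto
    then show ?case
      using single[of j] entry[of j] less.prems by (auto split: if_splits)
  qed
  show ?thesis
    using single[OF zero] entry[of i] by simp
qed

lemma trace_inv_modified_Cholesky:
  fixes L D A :: "'m::{finite,linorder} real_mat"
  assumes L: "unit_lower_triangular L" and D: "pos_diagonal D"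
  shows "trace (matrix_inv (L ** D ** transpose L) ** A)
    = (\<Sum>i\<in>UNIV. matrix_inv L $ i \<bullet> (A *v (matrix_inv L $ i)) / D $ i $ i)"
proof -
  let ?R = "matrix_inv L" and ?D' = "\<chi> i j. if i = j then 1 / D $ i $ i else 0"
  have LR: "L ** ?R = mat 1"
    using det_unit_lower_triangular[OF L] by (intro matrix_inv_right) simp
  have RL: "?R ** L = mat 1"
    using LR matrix_left_right_inverse by blast
  have LRt: "transpose L ** transpose ?R = mat 1"
    using RL by (metis matrix_transpose_mul transpose_mat)
  have DD: "D ** ?D' = mat 1"
  proof -
    have "(\<Sum>k\<in>UNIV. D $ i $ k * (if k = j then 1 / D $ k $ k else 0)) = (if i = j then 1 else 0)" for i j
      using D by (simp add: if_distrib[of "\<lambda>x. D $ i $ _ * x"] pos_diagonal_def cong: if_cong)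
        (metis less_irrefl)
    then show ?thesis
      by (simp add: matrix_matrix_mult_def mat_def vec_eq_iff)
  qed
  have "(L ** D ** transpose L) ** (transpose ?R ** ?D' ** ?R)
      = L ** (D ** (transpose L ** transpose ?R) ** ?D') ** ?R"
    by (simp add: matrix_mul_assoc)
  also have "\<dots> = mat 1"
    by (simp add: LRt DD LR)
  finally have inv: "matrix_inv (L ** D ** transpose L) = transpose ?R ** (?D' ** ?R)"
    by (simp add: matrix_inv_eqI matrix_mul_assoc)
  have D'_mult: "(?D' ** B) $ i $ i = B $ i $ i / D $ i $ i" for B :: "'m real_mat" and i
    by (simp add: matrix_matrix_mult_def if_distrib[of "\<lambda>x. x * _"] cong: if_cong)
  have diag: "(?R ** A ** transpose ?R) $ i $ i = ?R $ i \<bullet> (A *v (?R $ i))" for i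
  proof -
    have "(?R ** A ** transpose ?R) $ i $ i = (?R ** (A ** transpose ?R)) $ i $ i"
      by (simp only: matrix_mul_assoc)
    also have "\<dots> = (\<Sum>k\<in>UNIV. \<Sum>j\<in>UNIV. ?R $ i $ k * (A $ k $ j * ?R $ i $ j))"
      by (simp add: matrix_matrix_mult_def transpose_def sum_distrib_left)
    finally show ?thesis
      by (simp add: inner_vec_def matrix_vector_mult_def sum_distrib_left)
  qed
  have "trace (matrix_inv (L ** D ** transpose L) ** A) = trace (transpose ?R ** (?D' ** ?R ** A))"
    by (simp add: inv matrix_mul_assoc)
  also have "\<dots> = trace (?D' ** ?R ** A ** transpose ?R)"
    by (rule trace_mul_sym)
  also have "\<dots> = trace (?D' ** (?R ** A ** transpose ?R))"
    by (simp add: matrix_mul_assoc)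
  also have "\<dots> = (\<Sum>i\<in>UNIV. (?R ** A ** transpose ?R) $ i $ i / D $ i $ i)"
    by (simp only: trace_def D'_mult)
  also have "\<dots> = (\<Sum>i\<in>UNIV. ?R $ i \<bullet> (A *v (?R $ i)) / D $ i $ i)"
    by (simp add: diag)
  finally show ?thesis .
qed

lemma trace_mult_outer_product:
  "trace (A ** outer_product y y) = y \<bullet> (A *v y)"
  by (simp add: trace_def matrix_matrix_mult_def outer_product_def inner_vec_def
      matrix_vector_mult_def sum_distrib_left ac_simps)

lemma pos_def_coercive:
  fixes U :: "'m::finite real_mat"
  assumes "pos_def U"
  obtains c where "0 < c" "\<And>x. c * (x \<bullet> x) \<le> x \<bullet> (U *v x)"
proof -
  let ?S = "sphere 0 1 :: 'm real_vec set"
  have "?S \<noteq> {}"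
    using vector_choose_size[of 1] by auto
  moreover have "continuous_on ?S (\<lambda>x. x \<bullet> (U *v x))"
    by (intro continuous_intros linear_continuous_on matrix_vector_mul_bounded_linear)
  ultimately obtain x0 where x0: "x0 \<in> ?S" "\<And>x. x \<in> ?S \<Longrightarrow> x0 \<bullet> (U *v x0) \<le> x \<bullet> (U *v x)"
    using continuous_attains_inf[OF compact_sphere, of 0 1 "\<lambda>x. x \<bullet> (U *v x)"] by auto
  show thesis
  proof
    have "x0 \<noteq> 0"
      using x0(1) by auto
    then show "0 < x0 \<bullet> (U *v x0)"
      using assms by (simp add: pos_def_def)
    fix x :: "'m real_vec"
    show "x0 \<bullet> (U *v x0) * (x \<bullet> x) \<le> x \<bullet> (U *v x)"
    proof (cases "x = 0")
      case False
      let ?u = "(1 / norm x) *\<^sub>R x"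
      have "x0 \<bullet> (U *v x0) \<le> ?u \<bullet> (U *v ?u)"
        using False by (intro x0(2)) simp
      also have "\<dots> = x \<bullet> (U *v x) / (norm x)\<^sup>2"
        by (simp add: matrix_vector_mult_scaleR power2_eq_square)
      finally show ?thesis
        using False by (simp add: pos_le_divide_eq power2_norm_eq_inner)
    qed simp
  qed
qed

section \<open>Measurability and the reference measure\<close>

lemma PiM_density:
  fixes f :: "'a \<Rightarrow> ennreal"
  assumes I: "finite I" and M: "sigma_finite_measure M"
    and f[measurable]: "f \<in> borel_measurable M" and fin: "\<And>x. f x \<noteq> \<infinity>"
  shows "PiM I (\<lambda>_. density M f) = density (PiM I (\<lambda>_. M)) (\<lambda>x. \<Prod>i\<in>I. f (x i))"
proof -
  have D: "sigma_finite_measure (density M f)"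
    using sigma_finite_measure.sigma_finite_iff_density_finite[OF M f] fin by simp
  interpret D: product_sigma_finite "\<lambda>_. density M f"
    by standard (use D in \<open>auto simp: sigma_finite_measure_def\<close>)
  interpret P: product_sigma_finite "\<lambda>_. M"
    by standard (use M in \<open>auto simp: sigma_finite_measure_def\<close>)
  show ?thesis
  proof (rule D.PiM_eqI[symmetric, OF I])
    show "sets (density (PiM I (\<lambda>_. M)) (\<lambda>x. \<Prod>i\<in>I. f (x i))) = sets (PiM I (\<lambda>_. density M f))"
      by (simp cong: sets_PiM_cong)
    fix A assume "\<And>i. i \<in> I \<Longrightarrow> A i \<in> sets (density M f)"
    then have A[measurable]: "A i \<in> sets M" if "i \<in> I" for i
      using that by simp
    have "Pi\<^sub>E I A \<in> sets (PiM I (\<lambda>_. M))"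
      using I A by (intro sets_PiM_I_finite) auto
    then have "emeasure (density (PiM I (\<lambda>_. M)) (\<lambda>x. \<Prod>i\<in>I. f (x i))) (Pi\<^sub>E I A)
        = (\<integral>\<^sup>+x. (\<Prod>i\<in>I. f (x i)) * indicator (Pi\<^sub>E I A) x \<partial>PiM I (\<lambda>_. M))"
      by (subst emeasure_density) auto
    also have "\<dots> = (\<integral>\<^sup>+x. (\<Prod>i\<in>I. f (x i) * indicator (A i) (x i)) \<partial>PiM I (\<lambda>_. M))"
    proof (intro nn_integral_cong)
      fix x assume "x \<in> space (PiM I (\<lambda>_. M))"
      then have "indicator (Pi\<^sub>E I A) x = (\<Prod>i\<in>I. indicator (A i) (x i) :: ennreal)"
        using I by (auto simp: space_PiM indicator_def PiE_def Pi_iff)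
      then show "(\<Prod>i\<in>I. f (x i)) * indicator (Pi\<^sub>E I A) x
          = (\<Prod>i\<in>I. f (x i) * indicator (A i) (x i))"
        by (simp add: prod.distrib)
    qed
    also have "\<dots> = (\<Prod>i\<in>I. \<integral>\<^sup>+x. f x * indicator (A i) x \<partial>M)"
      using I by (intro P.product_nn_integral_prod) auto
    also have "\<dots> = (\<Prod>i\<in>I. emeasure (density M f) (A i))"
      by (intro prod.cong refl) (simp add: emeasure_density)
    finally show "emeasure (density (PiM I (\<lambda>_. M)) (\<lambda>x. \<Prod>i\<in>I. f (x i))) (Pi\<^sub>E I A)
        = (\<Prod>i\<in>I. emeasure (density M f) (A i))" .
  qed
qed

lemma nn_integral_PiM_lborel_scale:
  fixes f :: "('i::finite \<Rightarrow> real) \<Rightarrow> ennreal"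
  assumes c: "0 < c" and f[measurable]: "f \<in> borel_measurable (PiM UNIV (\<lambda>_. lborel))"
  shows "(\<integral>\<^sup>+x. f x \<partial>PiM UNIV (\<lambda>_. lborel))
    = ennreal (c ^ CARD('i)) * (\<integral>\<^sup>+x. f (\<lambda>i. c * x i) \<partial>PiM UNIV (\<lambda>_. lborel))"
proof -
  interpret product_sigma_finite "\<lambda>_::'i. lborel :: real measure"
    by standard
  let ?P = "PiM UNIV (\<lambda>_. lborel) :: ('i \<Rightarrow> real) measure"
  let ?s = "\<lambda>x i. c * x i :: real"
  have s[measurable]: "?s \<in> ?P \<rightarrow>\<^sub>M ?P"
    by (rule measurable_PiM_single') (auto simp: space_PiM)
  have "density (distr ?P ?P ?s) (\<lambda>_. ennreal (c ^ CARD('i))) = ?P"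
  proof (rule PiM_eqI)
    fix A :: "'i \<Rightarrow> real set" assume "\<And>i. i \<in> UNIV \<Longrightarrow> A i \<in> sets lborel"
    then have A[measurable]: "A i \<in> sets borel" for i
      by simp
    have A'[measurable]: "(*) c -` A i \<in> sets borel" for i
      using measurable_sets_borel[of "(*) c" borel "A i"] by simp
    have PA: "Pi\<^sub>E UNIV A \<in> sets ?P"
      by (intro sets_PiM_I_finite) auto
    then have "emeasure (density (distr ?P ?P ?s) (\<lambda>_. ennreal (c ^ CARD('i)))) (Pi\<^sub>E UNIV A)
        = ennreal (c ^ CARD('i)) * emeasure ?P (?s -` Pi\<^sub>E UNIV A \<inter> space ?P)"
      by (simp add: emeasure_density nn_integral_cmult emeasure_distr)
    also have "?s -` Pi\<^sub>E UNIV A \<inter> space ?P = Pi\<^sub>E UNIV (\<lambda>i. (*) c -` A i)"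
      by (auto simp: space_PiM)
    also have "ennreal (c ^ CARD('i)) * emeasure ?P \<dots>
        = (\<Prod>i\<in>UNIV. ennreal c * emeasure lborel ((*) c -` A i))"
      using c by (subst emeasure_PiM) (auto simp: prod.distrib ennreal_power)
    also have "\<dots> = (\<Prod>i\<in>UNIV. emeasure lborel (A i))"
    proof (intro prod.cong refl)
      fix i
      have "emeasure lborel (A i) = ennreal c * (\<integral>\<^sup>+x. indicator (A i) (c * x) \<partial>lborel)"
        using nn_integral_real_affine[of "indicator (A i)" c 0] c by simp
      also have "(\<integral>\<^sup>+x. indicator (A i) (c * x) \<partial>lborel) = (\<integral>\<^sup>+x. indicator ((*) c -` A i) x \<partial>lborel)"
        by (intro nn_integral_cong) (auto simp: indicator_def)
      finally show "ennreal c * emeasure lborel ((*) c -` A i) = emeasure lborel (A i)"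
        by simp
    qed
    finally show "emeasure (density (distr ?P ?P ?s) (\<lambda>_. ennreal (c ^ CARD('i)))) (Pi\<^sub>E UNIV A)
      = (\<Prod>i\<in>UNIV. emeasure lborel (A i))" .
  qed auto
  then have "(\<integral>\<^sup>+x. f x \<partial>?P)
      = (\<integral>\<^sup>+x. f x \<partial>density (distr ?P ?P ?s) (\<lambda>_. ennreal (c ^ CARD('i))))"
    by simp
  also have "\<dots> = ennreal (c ^ CARD('i)) * (\<integral>\<^sup>+x. f (\<lambda>i. c * x i) \<partial>?P)"
    by (simp add: nn_integral_density nn_integral_distr nn_integral_cmult)
  finally show ?thesis .
qed

lemma borel_measurable_matrix_iff:
  fixes F :: "'a \<Rightarrow> 'm::finite real_mat"
  shows "F \<in> borel_measurable N \<longleftrightarrow> (\<forall>i j. (\<lambda>x. F x $ i $ j) \<in> borel_measurable N)"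
proof
  assume F[measurable]: "F \<in> borel_measurable N"
  show "\<forall>i j. (\<lambda>x. F x $ i $ j) \<in> borel_measurable N"
  proof (intro allI)
    fix i j
    have "(\<lambda>A :: 'm real_mat. A $ i $ j) \<in> borel_measurable borel"
      by (intro borel_measurable_continuous_onI continuous_intros)
    then show "(\<lambda>x. F x $ i $ j) \<in> borel_measurable N"
      using measurable_compose[OF F] by blast
  qed
next
  assume "\<forall>i j. (\<lambda>x. F x $ i $ j) \<in> borel_measurable N"
  then show "F \<in> borel_measurable N"
    by (subst borel_measurable_euclidean_space) (auto simp: Basis_vec_def inner_axis)
qed

lemma borel_measurable_matrix_entry[measurable (raw)]:
  "F \<in> borel_measurable N \<Longrightarrow> (\<lambda>x. (F x :: 'm::finite real_mat) $ i $ j) \<in> borel_measurable N"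
  by (simp add: borel_measurable_matrix_iff)

lemma borel_measurable_det:
  assumes "\<And>i j. (\<lambda>x. (F x :: 'm::finite real_mat) $ i $ j) \<in> borel_measurable N"
  shows "(\<lambda>x. det (F x)) \<in> borel_measurable N"
  unfolding det_def using assms by measurable

lemma borel_measurable_matrix_mult:
  fixes F G :: "'a \<Rightarrow> 'm::finite real_mat"
  assumes [measurable]: "F \<in> borel_measurable N" "G \<in> borel_measurable N"
  shows "(\<lambda>x. F x ** G x) \<in> borel_measurable N"
  by (simp add: borel_measurable_matrix_iff matrix_matrix_mult_def)

lemma borel_measurable_matrix_inv:
  fixes F :: "'a \<Rightarrow> 'm::finite real_mat"
  assumes [measurable]: "F \<in> borel_measurable N" and nz: "\<And>x. x \<in> space N \<Longrightarrow> det (F x) \<noteq> 0"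
  shows "(\<lambda>x. matrix_inv (F x)) \<in> borel_measurable N"
proof -
  have "(\<lambda>x. matrix_inv (F x) $ k $ l) \<in> borel_measurable N" for k l
  proof -
    have "(\<lambda>x. det (\<chi> i j. if j = k then (if i = l then 1 else 0) else F x $ i $ j) / det (F x))
        \<in> borel_measurable N"
      by (intro borel_measurable_divide borel_measurable_det) simp_all
    then show ?thesis
      by (rule measurable_cong[THEN iffD1, rotated]) (simp add: matrix_inv_entry nz)
  qed
  then show ?thesis by (simp add: borel_measurable_matrix_iff)
qed

lemma ThetaD:
  assumes "(L, D) \<in> Theta E"
  shows "unit_lower_triangular L" "pos_diagonal D" "0 < D $ i $ i"
  using assms by (auto simp: Theta_def L_graph_def pos_diagonal_def)

lemma borel_measurable_fst_snd:
  "fst \<in> borel \<rightarrow>\<^sub>M (borel :: 'a::topological_space measure)"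
  "snd \<in> borel \<rightarrow>\<^sub>M (borel :: 'b::topological_space measure)"
  by (auto intro!: borel_measurable_continuous_onI
      simp: continuous_on_fst[OF continuous_on_id] continuous_on_snd[OF continuous_on_id])

lemma sets_borel_Theta[measurable]:
  fixes E :: "('m::{finite,linorder}) rel"
  shows "Theta E \<in> sets borel"
proof -
  note [measurable] = borel_measurable_fst_snd
  have "{\<theta> \<in> space borel. \<theta> \<in> Theta E} \<in> sets borel"
    unfolding Theta_def L_graph_def unit_lower_triangular_def pos_diagonal_def mem_Collect_eq case_prod_beta
    by measurable
  then show ?thesis by simp
qed

lemma space_restrict_Theta: "space (restrict_space borel (Theta E)) = Theta E"
  by (simp add: space_restrict_space)

lemma measurable_fst_snd_Theta:
  assumes "\<theta> \<in> N \<rightarrow>\<^sub>M restrict_space borel (Theta E)"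
  shows "(\<lambda>x. fst (\<theta> x)) \<in> borel_measurable N" "(\<lambda>x. snd (\<theta> x)) \<in> borel_measurable N"
proof -
  have "\<theta> \<in> borel_measurable N"
    using assms by (simp add: measurable_restrict_space2_iff)
  then show "(\<lambda>x. fst (\<theta> x)) \<in> borel_measurable N" "(\<lambda>x. snd (\<theta> x)) \<in> borel_measurable N"
    by (auto intro: measurable_compose borel_measurable_fst_snd)
qed

lemma borel_measurable_pi_unnorm:
  fixes E :: "('m::{finite,linorder}) rel"
  assumes \<theta>: "\<theta> \<in> N \<rightarrow>\<^sub>M restrict_space borel (Theta E)" and U[measurable]: "U \<in> borel_measurable N"
  shows "(\<lambda>x. pi_unnorm (U x) \<alpha> (\<theta> x)) \<in> borel_measurable N"
proof -
  let ?L = "\<lambda>x. fst (\<theta> x)" and ?D = "\<lambda>x. snd (\<theta> x)"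
  note [measurable] = measurable_fst_snd_Theta[OF \<theta>]
  have "(\<lambda>x. transpose (?L x)) \<in> borel_measurable N"
    by (simp add: borel_measurable_matrix_iff transpose_def)
  then have S: "(\<lambda>x. ?L x ** ?D x ** transpose (?L x)) \<in> borel_measurable N"
    by (intro borel_measurable_matrix_mult) measurable
  have nz: "det (?L x ** ?D x ** transpose (?L x)) \<noteq> 0" if "x \<in> space N" for x
  proof -
    have "(?L x, ?D x) \<in> Theta E"
      using measurable_space[OF \<theta> that] by (simp add: space_restrict_Theta)
    note T = ThetaD[OF this]
    show ?thesis
      unfolding det_modified_Cholesky[OF T(1,2)]
      using prod_pos[of UNIV "\<lambda>i. ?D x $ i $ i"] T(3) by (metis less_irrefl)
  qed
  have [measurable]: "(\<lambda>x. matrix_inv (?L x ** ?D x ** transpose (?L x)) ** U x) \<in> borel_measurable N"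
    by (intro borel_measurable_matrix_mult borel_measurable_matrix_inv S nz U)
  show ?thesis
    unfolding pi_unnorm_def case_prod_beta trace_def by measurable
qed

lemma matrices_of_coords_in_Theta:
  "matrices_of_coords E (l, d) \<in> Theta E \<longleftrightarrow> (\<forall>i. 0 < d i)"
  by (auto simp: matrices_of_coords_def Theta_def L_graph_def unit_lower_triangular_def
      pos_diagonal_def lower_edges_def)

lemma measurable_matrices_of_coords[measurable]:
  "matrices_of_coords E \<in> borel_measurable (PiM (lower_edges E) (\<lambda>_. lborel) \<Otimes>\<^sub>M PiM UNIV (\<lambda>_. lborel))"
proof -
  let ?N = "PiM (lower_edges E) (\<lambda>_. lborel) \<Otimes>\<^sub>M PiM UNIV (\<lambda>_. lborel :: real measure)"
  have l: "(\<lambda>x. fst x e) \<in> borel_measurable ?N" if "e \<in> lower_edges E" for e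
    using that by measurable
  have l': "(\<lambda>x. if i = j then 1 else if (i, j) \<in> lower_edges E then fst x (i, j) else 0)
      \<in> borel_measurable ?N" for i j
    using l[of "(i, j)"] by (cases "i = j"; cases "(i, j) \<in> lower_edges E") simp_all
  have d: "(\<lambda>x. snd x i) \<in> borel_measurable ?N" for i
    by measurable
  have "(\<lambda>x. (fst (matrices_of_coords E x), snd (matrices_of_coords E x))) \<in> borel_measurable ?N"
    unfolding matrices_of_coords_def case_prod_beta fst_conv snd_conv
    by (intro borel_measurable_Pair borel_measurable_matrix_iff[THEN iffD2] allI)
      (simp_all add: l' d cong: if_cong)
  then show ?thesis by simp
qed

lemma sets_dL_dD[measurable_cong]: "sets (dL_dD E) = sets (restrict_space borel (Theta E))"
  by (auto simp: dL_dD_def intro!: sets_restrict_space_cong)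

lemma nn_integral_dL_dD:
  fixes E :: "('m::{finite,linorder}) rel"
  assumes f: "f \<in> borel_measurable (restrict_space borel (Theta E))"
  shows "(\<integral>\<^sup>+\<theta>. f \<theta> \<partial>dL_dD E)
    = (\<integral>\<^sup>+l. \<integral>\<^sup>+d. f (matrices_of_coords E (l, d)) * indicator {d. \<forall>i. 0 < d i} d
        \<partial>PiM UNIV (\<lambda>_. lborel) \<partial>PiM (lower_edges E) (\<lambda>_. lborel))"
    and "(\<lambda>x. f (matrices_of_coords E x) * indicator {d. \<forall>i. 0 < d i} (snd x)) \<in> borel_measurable
      (PiM (lower_edges E) (\<lambda>_. lborel) \<Otimes>\<^sub>M PiM UNIV (\<lambda>_. lborel))"
proof -
  let ?D = "PiM UNIV (\<lambda>_. lborel) :: ('m \<Rightarrow> real) measure"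
  let ?N = "PiM (lower_edges E) (\<lambda>_. lborel) \<Otimes>\<^sub>M ?D"
  interpret D: product_sigma_finite "\<lambda>_::'m. lborel :: real measure" by standard
  interpret D: sigma_finite_measure ?D by (intro D.sigma_finite) simp
  have f'[measurable]: "(\<lambda>\<theta>. f \<theta> * indicator (Theta E) \<theta>) \<in> borel_measurable borel"
    using f by (simp add: borel_measurable_restrict_space_iff_ennreal)
  have eq: "f (matrices_of_coords E x) * indicator (Theta E) (matrices_of_coords E x)
      = f (matrices_of_coords E x) * indicator {d. \<forall>i. 0 < d i} (snd x)" for x
    by (cases x) (simp add: indicator_def matrices_of_coords_in_Theta)
  have "(\<lambda>x. f (matrices_of_coords E x) * indicator (Theta E) (matrices_of_coords E x)) \<in> borel_measurable ?N"
    by (rule measurable_compose[OF measurable_matrices_of_coords f'])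
  then show meas: "(\<lambda>x. f (matrices_of_coords E x) * indicator {d. \<forall>i. 0 < d i} (snd x)) \<in> borel_measurable ?N"
    by (simp add: eq)
  have "(\<integral>\<^sup>+\<theta>. f \<theta> \<partial>dL_dD E)
      = (\<integral>\<^sup>+\<theta>. f \<theta> * indicator (Theta E) \<theta> \<partial>distr ?N borel (matrices_of_coords E))"
    unfolding dL_dD_def by (subst nn_integral_restrict_space) simp_all
  also have "\<dots> = (\<integral>\<^sup>+x. f (matrices_of_coords E x) * indicator {d. \<forall>i. 0 < d i} (snd x) \<partial>?N)"
    by (subst nn_integral_distr) (simp_all add: eq)
  also have "\<dots> = (\<integral>\<^sup>+l. \<integral>\<^sup>+d. f (matrices_of_coords E (l, d)) * indicator {d. \<forall>i. 0 < d i} d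
        \<partial>?D \<partial>PiM (lower_edges E) (\<lambda>_. lborel))"
    by (subst D.nn_integral_fst[symmetric, OF meas]) simp
  finally show "(\<integral>\<^sup>+\<theta>. f \<theta> \<partial>dL_dD E) = \<dots>" .
qed

section \<open>The normalizing constant and the likelihood\<close>

definition inv_row_form :: "('m::finite) real_mat \<Rightarrow> 'm real_mat \<Rightarrow> 'm \<Rightarrow> real" where
  "inv_row_form A L i = matrix_inv L $ i \<bullet> (A *v (matrix_inv L $ i))"

lemma pi_unnorm_Theta:
  assumes "(L, D) \<in> Theta E"
  shows "pi_unnorm U \<alpha> (L, D) = exp (- (1/2) *
    (\<Sum>i\<in>UNIV. inv_row_form U L i / D $ i $ i + \<alpha> $ i * ln (D $ i $ i)))"
  using ThetaD[OF assms]
  by (simp add: pi_unnorm_def trace_inv_modified_Cholesky inv_row_form_def sum.distrib)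

lemma inv_row_form_scaleR: "inv_row_form (c *\<^sub>R U) L i = c * inv_row_form U L i"
  by (simp add: inv_row_form_def scaleR_matrix_vector_assoc[symmetric])

lemma inv_row_form_add: "inv_row_form (A + U) L i = inv_row_form A L i + inv_row_form U L i"
  by (simp add: inv_row_form_def matrix_vector_mult_add_rdistrib inner_right_distrib)

lemma inv_row_form_ge:
  fixes L :: "('m::{finite,linorder}) real_mat"
  assumes L: "unit_lower_triangular L" and c: "0 \<le> c" "\<And>x. c * (x \<bullet> x) \<le> x \<bullet> (U *v x)"
  shows "c \<le> inv_row_form U L i"
proof -
  let ?r = "matrix_inv L $ i"
  have "(?r $ i)\<^sup>2 \<le> ?r \<bullet> ?r"
    unfolding inner_vec_def power2_eq_square inner_real_def
    by (rule member_le_sum) auto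
  then have "1 \<le> ?r \<bullet> ?r"
    by (simp add: matrix_inv_unit_lower_triangular_diag[OF L])
  then have "c * 1 \<le> c * (?r \<bullet> ?r)"
    using c(1) by (rule mult_left_mono)
  then show ?thesis
    using c(2)[of ?r] by (simp add: inv_row_form_def)
qed

lemma borel_measurable_ennreal_pi_unnorm[measurable]:
  "(\<lambda>\<theta>. ennreal (pi_unnorm U \<alpha> \<theta>)) \<in> borel_measurable (restrict_space borel (Theta E))"
  by (intro measurable_compose[OF borel_measurable_pi_unnorm[where E=E] measurable_ennreal] measurable_ident_sets) auto

lemma z_graph_scaleR:
  fixes E :: "('m::{finite,linorder}) rel"
  assumes c: "0 < c"
  shows "z_graph E (c *\<^sub>R U) \<alpha>
    = ennreal (c ^ CARD('m) * exp (- (1/2) * ln c * (\<Sum>i\<in>UNIV. \<alpha> $ i))) * z_graph E U \<alpha>"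
proof -
  let ?m = "matrices_of_coords E" and ?Q = "{d :: 'm \<Rightarrow> real. \<forall>i. 0 < d i}"
  let ?PL = "PiM (lower_edges E) (\<lambda>_. lborel) :: ('m \<times> 'm \<Rightarrow> real) measure"
  let ?PD = "PiM UNIV (\<lambda>_. lborel) :: ('m \<Rightarrow> real) measure"
  let ?k = "exp (- (1/2) * ln c * (\<Sum>i\<in>UNIV. \<alpha> $ i))"
  let ?F = "\<lambda>U x. ennreal (pi_unnorm U \<alpha> (?m x)) * indicator ?Q (snd x)"
  interpret PD: product_sigma_finite "\<lambda>_::'m. lborel :: real measure" by standard
  interpret PD: sigma_finite_measure ?PD by (intro PD.sigma_finite) simp
  have F[measurable]: "?F U \<in> borel_measurable (?PL \<Otimes>\<^sub>M ?PD)" for U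
    by (rule nn_integral_dL_dD(2)[OF borel_measurable_ennreal_pi_unnorm])
  have z: "z_graph E U \<alpha> = (\<integral>\<^sup>+l. \<integral>\<^sup>+d. ?F U (l, d) \<partial>?PD \<partial>?PL)" for U
    unfolding z_graph_def by (subst nn_integral_dL_dD(1)[OF borel_measurable_ennreal_pi_unnorm]) simp
  have scale: "?F (c *\<^sub>R U) (l, \<lambda>i. c * d i) = ennreal ?k * ?F U (l, d)" for l d
  proof (cases "\<forall>i. 0 < d i")
    case True
    then have Th: "?m (l, d) \<in> Theta E" "?m (l, \<lambda>i. c * d i) \<in> Theta E"
      using c by (simp_all add: matrices_of_coords_in_Theta)
    define L D where "L = fst (?m (l, d))" and "D = snd (?m (l, d))"
    then have m: "?m (l, d) = (L, D)"
      by simp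
    have D: "D $ i $ i = d i" for i
      by (simp add: D_def matrices_of_coords_def)
    have m': "?m (l, \<lambda>i. c * d i) = (L, c *\<^sub>R D)"
      by (simp add: L_def D_def matrices_of_coords_def vec_eq_iff)
    have "inv_row_form (c *\<^sub>R U) L i / (c *\<^sub>R D) $ i $ i + \<alpha> $ i * ln ((c *\<^sub>R D) $ i $ i)
        = (inv_row_form U L i / D $ i $ i + \<alpha> $ i * ln (D $ i $ i)) + ln c * \<alpha> $ i" for i
      using c True[rule_format, of i] by (simp add: inv_row_form_scaleR D ln_mult algebra_simps)
    then have "pi_unnorm (c *\<^sub>R U) \<alpha> (L, c *\<^sub>R D) = exp (- (1/2) *
        ((\<Sum>i\<in>UNIV. inv_row_form U L i / D $ i $ i + \<alpha> $ i * ln (D $ i $ i)) + ln c * (\<Sum>i\<in>UNIV. \<alpha> $ i)))"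
      using Th unfolding m m' by (simp only: pi_unnorm_Theta sum.distrib sum_distrib_left)
    also have "\<dots> = ?k * pi_unnorm U \<alpha> (L, D)"
      using Th unfolding m by (simp add: pi_unnorm_Theta exp_add[symmetric] algebra_simps)
    finally have "pi_unnorm (c *\<^sub>R U) \<alpha> (L, c *\<^sub>R D) = ?k * pi_unnorm U \<alpha> (L, D)" .
    then show ?thesis
      using True c by (simp add: m m' ennreal_mult')
  qed (use c in \<open>auto simp: zero_less_mult_iff\<close>)
  have "z_graph E (c *\<^sub>R U) \<alpha>
      = (\<integral>\<^sup>+l. ennreal (c ^ CARD('m)) * (\<integral>\<^sup>+d. ?F (c *\<^sub>R U) (l, \<lambda>i. c * d i) \<partial>?PD) \<partial>?PL)"
    unfolding z using c
    by (intro nn_integral_cong nn_integral_PiM_lborel_scale measurable_compose[OF measurable_Pair1' F])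
  also have "\<dots> = (\<integral>\<^sup>+l. ennreal (c ^ CARD('m)) * (ennreal ?k * (\<integral>\<^sup>+d. ?F U (l, d) \<partial>?PD)) \<partial>?PL)"
    unfolding scale
    by (intro nn_integral_cong arg_cong2[where f="(*)"] refl nn_integral_cmult
        measurable_compose[OF measurable_Pair1' F])
  also have "\<dots> = ennreal (c ^ CARD('m)) * (ennreal ?k * (\<integral>\<^sup>+l. \<integral>\<^sup>+d. ?F U (l, d) \<partial>?PD \<partial>?PL))"
    using PD.borel_measurable_nn_integral_fst[OF F, of U] by (simp add: nn_integral_cmult)
  also have "\<dots> = ennreal (c ^ CARD('m) * ?k) * z_graph E U \<alpha>"
    using c by (simp add: z ennreal_mult mult.assoc)
  finally show ?thesis .
qed

text \<open>The extra factor \<open>D\<^sub>i\<^sub>i powr (-n/2)\<close>, unbounded as \<open>D\<^sub>i\<^sub>i\<close> tends to 0, is absorbed by half of the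
  exponential decay \<open>exp (- q / (2 D\<^sub>i\<^sub>i))\<close>, since \<open>q\<close> is bounded below uniformly in \<open>L\<close>.\<close>
lemma pi_unnorm_posterior_le:
  fixes U A :: "('m::{finite,linorder}) real_mat"
  assumes U: "pos_def U" and A: "\<And>x. 0 \<le> x \<bullet> (A *v x)" and n: "0 < n"
  obtains C where "\<And>\<theta>. \<theta> \<in> Theta E \<Longrightarrow>
    pi_unnorm (A + U) (\<chi> i. n + \<alpha> $ i) \<theta> \<le> C * pi_unnorm ((1/2) *\<^sub>R U) \<alpha> \<theta>"
proof -
  obtain c where c: "0 < c" "\<And>x. c * (x \<bullet> x) \<le> x \<bullet> (U *v x)"
    using pos_def_coercive[OF U] by blast
  define K where "K = n / 2 * (ln (2 * n / c) - 1)"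
  have key: "- (1/2) * (q / (2 * d) + n * ln d) \<le> K" if "c \<le> q" "0 < d" for q d
  proof -
    have "ln (c / (2 * n * d)) \<le> c / (2 * n * d) - 1"
      using c(1) n that by (intro ln_le_minus_one) simp
    moreover have "ln (c / (2 * n * d)) = - ln (2 * n / c) - ln d"
      using c(1) n that by (simp add: ln_div ln_mult)
    ultimately have "n / 2 * (- ln d) \<le> n / 2 * (c / (2 * n * d) - 1 + ln (2 * n / c))"
      using n by (intro mult_left_mono) auto
    also have "\<dots> = c / (4 * d) + K"
      using n that by (simp add: K_def field_simps)
    also have "c / (4 * d) \<le> q / (4 * d)"
      using that by (simp add: divide_right_mono)
    finally show ?thesis
      by (simp add: field_simps)
  qed
  show thesis
  proof
    fix \<theta> :: "'m real_mat \<times> 'm real_mat" assume "\<theta> \<in> Theta E"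
    then obtain L D where \<theta>: "\<theta> = (L, D)" and T: "(L, D) \<in> Theta E"
      by (cases \<theta>) auto
    have "- (1/2) * (inv_row_form (A + U) L i / D $ i $ i + (n + \<alpha> $ i) * ln (D $ i $ i))
        \<le> K + - (1/2) * (inv_row_form ((1/2) *\<^sub>R U) L i / D $ i $ i + \<alpha> $ i * ln (D $ i $ i))" for i
    proof -
      have d: "0 < D $ i $ i" using ThetaD[OF T] by simp
      have "0 \<le> inv_row_form A L i"
        using A by (simp add: inv_row_form_def)
      then have "0 \<le> inv_row_form A L i / D $ i $ i"
        using d by simp
      moreover have "c \<le> inv_row_form U L i"
        using c ThetaD[OF T] by (intro inv_row_form_ge) auto
      ultimately show ?thesis
        using key[OF _ d, of "inv_row_form U L i"]
        by (simp add: inv_row_form_add inv_row_form_scaleR add_divide_distrib algebra_simps)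
    qed
    then have "(\<Sum>i\<in>UNIV. - (1/2) * (inv_row_form (A + U) L i / D $ i $ i + (n + \<alpha> $ i) * ln (D $ i $ i)))
        \<le> (\<Sum>i\<in>UNIV. K + - (1/2) * (inv_row_form ((1/2) *\<^sub>R U) L i / D $ i $ i + \<alpha> $ i * ln (D $ i $ i)))"
      by (rule sum_mono)
    also have "\<dots> = CARD('m) * K + - (1/2) *
        (\<Sum>i\<in>UNIV. inv_row_form ((1/2) *\<^sub>R U) L i / D $ i $ i + \<alpha> $ i * ln (D $ i $ i))"
      by (simp only: sum.distrib sum_distrib_left[symmetric] sum_constant)
    finally show "pi_unnorm (A + U) (\<chi> i. n + \<alpha> $ i) \<theta>
        \<le> exp (CARD('m) * K) * pi_unnorm ((1/2) *\<^sub>R U) \<alpha> \<theta>"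
      by (simp only: \<theta> pi_unnorm_Theta[OF T] exp_add[symmetric] exp_le_cancel_iff
          sum_distrib_left[symmetric] vec_lambda_beta)
  qed
qed

lemma z_graph_posterior_finite:
  fixes E :: "('m::{finite,linorder}) rel"
  assumes U: "pos_def U" and A: "\<And>x. 0 \<le> x \<bullet> (A *v x)" and n: "0 < n"
    and fin: "z_graph E U \<alpha> < \<infinity>"
  shows "z_graph E (A + U) (\<chi> i. n + \<alpha> $ i) < \<infinity>"
proof -
  obtain C where C: "\<And>\<theta>. \<theta> \<in> Theta E \<Longrightarrow>
      pi_unnorm (A + U) (\<chi> i. n + \<alpha> $ i) \<theta> \<le> C * pi_unnorm ((1/2) *\<^sub>R U) \<alpha> \<theta>"
    using pi_unnorm_posterior_le[OF U A n] by blast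
  have space: "space (dL_dD E) = Theta E"
    using sets_eq_imp_space_eq[OF sets_dL_dD[of E]] by (simp add: space_restrict_Theta)
  have "z_graph E (A + U) (\<chi> i. n + \<alpha> $ i)
      \<le> (\<integral>\<^sup>+\<theta>. ennreal C * ennreal (pi_unnorm ((1/2) *\<^sub>R U) \<alpha> \<theta>) \<partial>dL_dD E)"
    unfolding z_graph_def
  proof (rule nn_integral_mono)
    fix \<theta> assume "\<theta> \<in> space (dL_dD E)"
    then have le: "pi_unnorm (A + U) (\<chi> i. n + \<alpha> $ i) \<theta> \<le> C * pi_unnorm ((1/2) *\<^sub>R U) \<alpha> \<theta>"
      using C by (simp add: space)
    have pos: "0 \<le> pi_unnorm V \<beta> \<theta>" for V \<beta>
      by (simp add: pi_unnorm_def case_prod_beta)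
    show "ennreal (pi_unnorm (A + U) (\<chi> i. n + \<alpha> $ i) \<theta>)
        \<le> ennreal C * ennreal (pi_unnorm ((1/2) *\<^sub>R U) \<alpha> \<theta>)"
      using ennreal_leI[OF le] pos by (simp add: ennreal_mult'')
  qed
  also have "\<dots> = ennreal C * z_graph E ((1/2) *\<^sub>R U) \<alpha>"
    by (simp add: z_graph_def nn_integral_cmult)
  also have "\<dots> < \<infinity>"
    using fin by (subst z_graph_scaleR) (simp_all add: ennreal_mult_less_top)
  finally show ?thesis .
qed

lemma z_graph_pos:
  fixes E :: "('m::{finite,linorder}) rel"
  assumes "0 < z_graph E U \<alpha>"
  shows "0 < z_graph E V \<beta>"
proof -
  have "ennreal (pi_unnorm U \<alpha> \<theta>) \<noteq> 0" for U \<alpha> and \<theta> :: "'m real_mat \<times> 'm real_mat"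
    by (simp add: pi_unnorm_def case_prod_beta)
  then have "z_graph E U \<alpha> = 0 \<longleftrightarrow> (AE \<theta> in dL_dD E. False)" for U \<alpha>
    unfolding z_graph_def by (subst nn_integral_0_iff_AE) simp_all
  then show ?thesis
    using assms by (metis not_gr_zero)
qed

lemma z_graph_pos_of_prob_space:
  assumes "prob_space (pi_dist E U \<alpha>)"
  shows "0 < z_graph E U \<alpha>"
proof (rule ccontr)
  interpret prob_space "pi_dist E U \<alpha>" by fact
  assume "\<not> 0 < z_graph E U \<alpha>"
  then have z: "z_graph E U \<alpha> = 0" by simp
  have "emeasure (pi_dist E U \<alpha>) (space (pi_dist E U \<alpha>))
      = (\<integral>\<^sup>+\<theta>. ennreal (pi_unnorm U \<alpha> \<theta>) / z_graph E U \<alpha> \<partial>dL_dD E)"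
    unfolding pi_dist_def by (simp add: emeasure_density cong: nn_integral_cong)
  also have "\<dots> = z_graph E U \<alpha> / z_graph E U \<alpha>"
    by (subst nn_integral_divide) (auto simp: z_graph_def)
  also have "\<dots> = 0" by (simp add: z)
  finally show False
    using emeasure_space_1 by simp
qed

lemma sample_cov_scaleR:
  assumes "1 \<le> n"
  shows "real n *\<^sub>R sample_cov n y = (\<Sum>k = 1..n. outer_product (y k) (y k))"
  using assms by (simp add: sample_cov_def)

lemma trace_mult_sum_outer_product:
  "trace (A ** (\<Sum>k\<in>I. outer_product (y k) (y k))) = (\<Sum>k\<in>I. y k \<bullet> (A *v y k))"
proof (induction I rule: infinite_finite_induct)
  case (insert k I)
  then show ?case
    by (simp add: matrix_add_ldistrib trace_add trace_mult_outer_product)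
qed (simp_all add: trace_def)

lemma sample_cov_psd:
  assumes "1 \<le> n"
  shows "0 \<le> x \<bullet> ((real n *\<^sub>R sample_cov n y) *v x)"
proof -
  have "x \<bullet> (outer_product v v *v x) = (v \<bullet> x)\<^sup>2" for v :: "'a real_vec"
    by (simp add: outer_product_def inner_vec_def matrix_vector_mult_def power2_eq_square
        sum_product sum_distrib_left ac_simps)
  moreover have "(\<Sum>k\<in>I. outer_product (y k) (y k)) *v x = (\<Sum>k\<in>I. outer_product (y k) (y k) *v x)" for I :: "nat set"
    by (induction I rule: infinite_finite_induct) (simp_all add: matrix_vector_mult_add_rdistrib)
  ultimately show ?thesis
    by (simp add: sample_cov_scaleR[OF assms] inner_sum_right sum_nonneg)
qed

definition normal_density_vec :: "('m::finite) real_mat \<Rightarrow> 'm real_vec \<Rightarrow> real" where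
  "normal_density_vec \<Sigma> x = exp (- (1/2) * (x \<bullet> (matrix_inv \<Sigma> *v x))) / sqrt ((2 * pi) ^ CARD('m) * det \<Sigma>)"

lemma prod_normal_density_vec:
  fixes L D :: "('m::{finite,linorder}) real_mat"
  assumes T: "(L, D) \<in> Theta E" and n: "1 \<le> n"
  shows "(\<Prod>k = 1..n. normal_density_vec (L ** D ** transpose L) (y k))
    = (1 / sqrt ((2 * pi) ^ CARD('m))) ^ n * pi_unnorm (real n *\<^sub>R sample_cov n y) (\<chi> i. real n) (L, D)"
proof -
  let ?S = "L ** D ** transpose L" and ?l = "\<Sum>i\<in>UNIV. ln (D $ i $ i)"
  have "det ?S = exp ?l"
    using ThetaD[OF T] by (simp add: det_modified_Cholesky exp_sum)
  then have "sqrt (det ?S) = exp (?l / 2)"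
    by (intro real_sqrt_unique) (simp_all add: power2_eq_square exp_add[symmetric])
  moreover have "exp (- (1/2) * (q + ?l)) = exp (- (1/2) * q) / exp (?l / 2)" for q
    by (subst exp_diff[symmetric]) (simp add: algebra_simps)
  ultimately have "normal_density_vec ?S v
      = 1 / sqrt ((2 * pi) ^ CARD('m)) * exp (- (1/2) * (v \<bullet> (matrix_inv ?S *v v) + ?l))" for v
    by (simp only: normal_density_vec_def real_sqrt_mult) simp
  then have "(\<Prod>k = 1..n. normal_density_vec ?S (y k)) = (1 / sqrt ((2 * pi) ^ CARD('m))) ^ n
      * exp (\<Sum>k = 1..n. - (1/2) * (y k \<bullet> (matrix_inv ?S *v y k) + ?l))"
    by (simp only: prod.distrib exp_sum finite_atLeastAtMost prod_constant card_atLeastAtMost) simp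
  also have "(\<Sum>k = 1..n. - (1/2) * (y k \<bullet> (matrix_inv ?S *v y k) + ?l))
      = - (1/2) * ((\<Sum>k = 1..n. y k \<bullet> (matrix_inv ?S *v y k)) + real n * ?l)"
    by (simp only: sum.distrib sum_distrib_left[symmetric] sum_constant card_atLeastAtMost) simp
  also have "exp \<dots> = pi_unnorm (real n *\<^sub>R sample_cov n y) (\<chi> i. real n) (L, D)"
    unfolding sample_cov_scaleR[OF n]
    by (simp add: pi_unnorm_def trace_mult_sum_outer_product sum_distrib_left)
  finally show ?thesis .
qed

lemma PiM_multivariate_normal:
  fixes L D :: "('m::{finite,linorder}) real_mat"
  assumes T: "(L, D) \<in> Theta E" and n: "1 \<le> n"
  shows "PiM {1..n} (\<lambda>_. multivariate_normal 0 (L ** D ** transpose L))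
    = density (PiM {1..n} (\<lambda>_. lborel)) (\<lambda>y. ennreal ((1 / sqrt ((2 * pi) ^ CARD('m))) ^ n
        * pi_unnorm (real n *\<^sub>R sample_cov n y) (\<chi> i. real n) (L, D)))"
proof -
  let ?S = "L ** D ** transpose L"
  have "0 < det ?S"
    using ThetaD[OF T] by (simp add: det_modified_Cholesky prod_pos)
  then have pos: "0 \<le> normal_density_vec ?S x" for x
    by (simp add: normal_density_vec_def)
  have cont: "continuous_on UNIV (\<lambda>x. x \<bullet> (matrix_inv ?S *v x))"
    by (intro continuous_intros linear_continuous_on matrix_vector_mul_bounded_linear)
  have [measurable]: "normal_density_vec ?S \<in> borel_measurable lborel"
    unfolding normal_density_vec_def using borel_measurable_continuous_onI[OF cont] by measurable
  have "PiM {1..n} (\<lambda>_. multivariate_normal 0 ?S)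
      = PiM {1..n} (\<lambda>_. density lborel (\<lambda>x. ennreal (normal_density_vec ?S x)))"
    by (simp add: multivariate_normal_def normal_density_vec_def)
  also have "\<dots> = density (PiM {1..n} (\<lambda>_. lborel)) (\<lambda>y. \<Prod>k\<in>{1..n}. ennreal (normal_density_vec ?S (y k)))"
    by (rule PiM_density) (auto intro: lborel.sigma_finite_measure_axioms)
  finally show ?thesis
    by (simp only: prod_ennreal[OF pos] prod_normal_density_vec[OF T n])
qed

lemma pi_unnorm_mult:
  "pi_unnorm A \<alpha> \<theta> * pi_unnorm U \<beta> \<theta> = pi_unnorm (A + U) (\<chi> i. \<alpha> $ i + \<beta> $ i) \<theta>"
  by (cases \<theta>) (simp add: pi_unnorm_def matrix_add_ldistrib trace_add exp_add[symmetric]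
      sum.distrib algebra_simps)

theorem lemma1:
  fixes E :: "('m::{finite,linorder}) rel"
    and U :: "'m real_mat"
    and \<alpha> :: "'m real_vec"
    and n :: nat
    and M :: "'w measure"
    and \<theta> :: "'w \<Rightarrow> 'm real_mat \<times> 'm real_mat"
    and Y :: "nat \<Rightarrow> 'w \<Rightarrow> 'm real_vec"
  assumes "simple_graph E" and "decomposable E" and "in_S_D E"
    and "pos_def U" and "\<And>i. 0 \<le> \<alpha> $ i" and "z_graph E U \<alpha> < \<infinity>"
    and "1 \<le> n"
    and "prob_space M"
    and "\<theta> \<in> M \<rightarrow>\<^sub>M restrict_space borel (Theta E)"
    and prior: "distr M (restrict_space borel (Theta E)) \<theta> = pi_dist E U \<alpha>"
    and sample: "cond_distribution M
           (PiM {1..n} (\<lambda>_. borel)) (\<lambda>\<omega>. \<lambda>k\<in>{1..n}. Y k \<omega>)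
           (restrict_space borel (Theta E)) \<theta>
           (\<lambda>(L, D). PiM {1..n} (\<lambda>_. multivariate_normal 0 (L ** D ** transpose L)))"
  shows "cond_distribution M
           (restrict_space borel (Theta E)) \<theta>
           (PiM {1..n} (\<lambda>_. borel)) (\<lambda>\<omega>. \<lambda>k\<in>{1..n}. Y k \<omega>)
           (\<lambda>y. pi_dist E (real n *\<^sub>R sample_cov n y + U) (\<chi> i. real n + \<alpha> $ i))"
proof -
  let ?T = "restrict_space borel (Theta E) :: ('m real_mat \<times> 'm real_mat) measure"
  let ?Y = "PiM {1..n} (\<lambda>_. borel) :: (nat \<Rightarrow> 'm real_vec) measure"
  let ?A = "\<lambda>y. real n *\<^sub>R sample_cov n y :: 'm real_mat"
  let ?\<beta> = "\<chi> i. real n + \<alpha> $ i"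
  define c where "c = (1 / sqrt ((2 * pi) ^ CARD('m))) ^ n"
  define f where "f \<theta> y = ennreal (c * pi_unnorm (?A y) (\<chi> i. real n) \<theta>)" for \<theta> y
  define z where "z = z_graph E U \<alpha>"
  define z' where "z' y = z_graph E (?A y + U) ?\<beta>" for y
  define g where "g y = ennreal c * z' y / z" for y
  have c: "0 < c" by (simp add: c_def)
  interpret prob_space M by fact
  have "prob_space (pi_dist E U \<alpha>)"
    unfolding prior[symmetric] by (rule prob_space_distr) fact
  then have z_pos: "0 < z" and z'_pos: "0 < z' y" for y
    unfolding z_def z'_def by (auto intro: z_graph_pos_of_prob_space z_graph_pos)
  have "z < \<infinity>"
    unfolding z_def by fact
  then obtain r where r: "0 < r" "z = ennreal r"
    using z_pos by (cases z) auto
  have "z' y < \<infinity>" for y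
    unfolding z'_def using \<open>1 \<le> n\<close>
    by (intro z_graph_posterior_finite sample_cov_psd \<open>pos_def U\<close> \<open>z_graph E U \<alpha> < \<infinity>\<close>) auto
  then have z': "\<exists>s>0. z' y = ennreal s" for y
    using z'_pos[of y] by (cases "z' y") (auto simp: less_top[symmetric])
  have pi_nonneg: "0 \<le> pi_unnorm V \<gamma> \<theta>" for V \<gamma> and \<theta> :: "'m real_mat \<times> 'm real_mat"
    by (simp add: pi_unnorm_def case_prod_beta)
  have prod: "ennreal (pi_unnorm U \<alpha> \<theta>) / z * f \<theta> y
      = ennreal c * ennreal (pi_unnorm (?A y + U) ?\<beta> \<theta>) / z" for \<theta> y
    using c pi_nonneg pi_unnorm_mult[of "?A y" "\<chi> i. real n" \<theta> U \<alpha>]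
    by (simp add: f_def divide_ennreal_def ennreal_mult[symmetric] mult.assoc mult.left_commute mult.commute)
  have f_y[measurable]: "(\<lambda>\<theta>. f \<theta> y) \<in> borel_measurable ?T" for y
    unfolding f_def using c by (simp add: ennreal_mult pi_nonneg)
  show ?thesis
  proof (rule bayes_cond_distribution[OF \<open>prob_space M\<close> sample, where f = f and g = g and P = "pi_dist E U \<alpha>"
        and Q = "PiM {1..n} (\<lambda>_. lborel)"])
    interpret product_sigma_finite "\<lambda>_::nat. lborel :: 'm real_vec measure" by standard
    show "sigma_finite_measure (PiM {1..n} (\<lambda>_. lborel :: 'm real_vec measure))"
      by (rule sigma_finite) simp
    show "sets (PiM {1..n} (\<lambda>_. lborel)) = sets ?Y"
      by (rule sets_PiM_cong) auto
    show "(\<lambda>(\<theta>, y). f \<theta> y) \<in> borel_measurable (?T \<Otimes>\<^sub>M ?Y)"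
    proof -
      have entry: "(\<lambda>x. snd x k $ i) \<in> borel_measurable (?T \<Otimes>\<^sub>M ?Y)" if k: "k \<in> {1..n}" for k i
      proof -
        have v: "(\<lambda>v :: 'm real_vec. v $ i) \<in> borel_measurable borel"
          by (intro borel_measurable_continuous_onI continuous_intros)
        have "(\<lambda>x. snd x k) \<in> ?T \<Otimes>\<^sub>M ?Y \<rightarrow>\<^sub>M borel"
          using k by measurable
        from measurable_compose[OF this v] show ?thesis .
      qed
      have "(\<lambda>x. ?A (snd x)) \<in> borel_measurable (?T \<Otimes>\<^sub>M ?Y)"
        unfolding sample_cov_scaleR[OF \<open>1 \<le> n\<close>] borel_measurable_matrix_iff
        by (auto simp: outer_product_def simp del: One_nat_def
            intro!: borel_measurable_sum borel_measurable_times entry)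
      then have "(\<lambda>x. pi_unnorm (?A (snd x)) (\<chi> i. real n) (fst x)) \<in> borel_measurable (?T \<Otimes>\<^sub>M ?Y)"
        by (intro borel_measurable_pi_unnorm) auto
      then show ?thesis
        unfolding f_def case_prod_beta by measurable
    qed
    show "(case \<theta> of (L, D) \<Rightarrow> PiM {1..n} (\<lambda>_. multivariate_normal 0 (L ** D ** transpose L)))
        = density (PiM {1..n} (\<lambda>_. lborel)) (f \<theta>)" if "\<theta> \<in> space ?T" for \<theta>
      using that \<open>1 \<le> n\<close> unfolding f_def c_def
      by (cases \<theta>) (simp only: prod.case space_restrict_Theta PiM_multivariate_normal)
    show "pi_dist E U \<alpha> = distr M ?T \<theta>"
      by (simp add: prior)
    show "g y = (\<integral>\<^sup>+\<theta>. f \<theta> y \<partial>pi_dist E U \<alpha>)" for y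
    proof -
      have "(\<integral>\<^sup>+\<theta>. f \<theta> y \<partial>pi_dist E U \<alpha>)
          = (\<integral>\<^sup>+\<theta>. ennreal c * ennreal (pi_unnorm (?A y + U) ?\<beta> \<theta>) / z \<partial>dL_dD E)"
        unfolding pi_dist_def z_def[symmetric] prod[symmetric]
        by (rule nn_integral_density) measurable
      also have "\<dots> = g y"
        by (simp add: g_def z'_def z_graph_def nn_integral_divide nn_integral_cmult)
      finally show ?thesis ..
    qed
    show "0 < g y" "g y < \<infinity>" for y
    proof -
      obtain s where "0 < s" "z' y = ennreal s"
        using z'[of y] by blast
      then have "g y = ennreal (c * s / r)" "0 < c * s / r"
        using c r by (simp_all add: g_def ennreal_mult[symmetric] divide_ennreal)
      then show "0 < g y" "g y < \<infinity>"
        by simp_all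
    qed
    show "pi_dist E (?A y + U) ?\<beta> = density (pi_dist E U \<alpha>) (\<lambda>\<theta>. f \<theta> y / g y)" for y
    proof -
      have "density (pi_dist E U \<alpha>) (\<lambda>\<theta>. f \<theta> y / g y)
          = density (dL_dD E) (\<lambda>\<theta>. ennreal (pi_unnorm U \<alpha> \<theta>) / z * (f \<theta> y / g y))"
        unfolding pi_dist_def z_def[symmetric] by (rule density_density_eq) measurable
      also have "(\<lambda>\<theta>. ennreal (pi_unnorm U \<alpha> \<theta>) / z * (f \<theta> y / g y))
          = (\<lambda>\<theta>. ennreal (pi_unnorm (?A y + U) ?\<beta> \<theta>) / z' y)"
      proof
        fix \<theta>
        have "ennreal (pi_unnorm U \<alpha> \<theta>) / z * (f \<theta> y / g y)
            = (ennreal c * ennreal (pi_unnorm (?A y + U) ?\<beta> \<theta>) / z) / (ennreal c * z' y / z)"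
          unfolding prod[symmetric] g_def by (simp add: ennreal_times_divide)
        also have "\<dots> = ennreal (pi_unnorm (?A y + U) ?\<beta> \<theta>) / z' y"
        proof -
          obtain s where s: "0 < s" "z' y = ennreal s"
            using z'[of y] by blast
          show ?thesis
            using c r s pi_nonneg by (simp add: ennreal_mult[symmetric] divide_ennreal)
        qed
        finally show "ennreal (pi_unnorm U \<alpha> \<theta>) / z * (f \<theta> y / g y)
            = ennreal (pi_unnorm (?A y + U) ?\<beta> \<theta>) / z' y" .
      qed
      finally show ?thesis
        by (simp add: pi_dist_def z'_def)
    qed
  qed
qed

end
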